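(* Consider an instance with cardinality-based rates $(N,d,(r_1,\dots,r_N))$ for which the all-at-once strategy $\mathcal H^N$ is non-degenerate, i.e. it consists of $N$ groups all run for strictly positive time durations. Then the inequalities $$\frac{1}{r_{m}}+\frac{1}{r_{m-2}}\le\frac{2}{r_{m-1}}\qquad\text{for all } m=2,\dots,N,$$ where the term $1/r_0$ (occurring for $m=2$) is taken to be $0$, are necessary for the optimality of $\mathcal H^N$; that is, if $\mathcal H^N$ is optimal then all of them hold.
   Context: $\mathcal N=\{1,\dots,N\}$ is a set of links with strictly positive demands $d_1,\dots,d_N$ (queue contents). $\mathcal H$ is the set of all nonempty subsets of $\mathcal N$, called groups. Cardinality-based rates: there are numbers $r_1\ge r_2\ge\dots\ge r_N>0$ such that, when group $\mathcal c$ is active, every link $i\in \mathcal c$ is served at rate $r_{|\mathcal c|}$ and links outside $\mathcal c$ at rate $0$. A schedule is a vector $T=(T_{\mathcal c})_{\mathcal c\in\mathcal H}\ge 0$ with $\sum_{\mathcal c\ni i}r_{|\mathcal c|}T_{\mathcal c}=d_i$ for every $i$; its length is $\sum_{\mathcal c}T_{\mathcal c}$; it is optimal if its length is minimum. The strategy $\mathcal H^N$: activate the group of all links until some queue becomes empty; the next group consists of all links with positive remaining demand, activated until some queue becomes empty; and so on until all queues are empty. (For cardinality-based rates, $\mathcal H^N$ is non-degenerate exactly when all demands are distinct.) *)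

theory Defs
  imports Complex_Main
begin

definition links :: "nat \<Rightarrow> nat set" where
  "links N = {1..N}"

definition groups :: "nat \<Rightarrow> nat set set" where
  "groups N = {c. c \<subseteq> links N \<and> c \<noteq> {}}"

text \<open>Only the values of \<open>d\<close> and \<open>r\<close> on \<open>{1..N}\<close> are constrained or used; in particular
  \<open>r 0\<close> is arbitrary.\<close>

definition cardinality_instance :: "nat \<Rightarrow> (nat \<Rightarrow> real) \<Rightarrow> (nat \<Rightarrow> real) \<Rightarrow> bool" where
  "cardinality_instance N d r \<longleftrightarrow>
     1 \<le> N \<and> (\<forall>i\<in>links N. 0 < d i) \<and> antimono_on {1..N} r \<and> 0 < r N"

definition service_rate :: "(nat \<Rightarrow> real) \<Rightarrow> nat set \<Rightarrow> nat \<Rightarrow> real" where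
  "service_rate r c i = (if i \<in> c then r (card c) else 0)"

text \<open>A schedule is a vector indexed by \<open>groups N\<close>; values of \<open>T\<close> on other sets are irrelevant.\<close>

definition is_schedule ::
    "nat \<Rightarrow> (nat \<Rightarrow> real) \<Rightarrow> (nat \<Rightarrow> real) \<Rightarrow> (nat set \<Rightarrow> real) \<Rightarrow> bool" where
  "is_schedule N d r T \<longleftrightarrow>
     (\<forall>c\<in>groups N. 0 \<le> T c) \<and>
     (\<forall>i\<in>links N. (\<Sum>c\<in>{c \<in> groups N. i \<in> c}. r (card c) * T c) = d i)"

definition schedule_length :: "nat \<Rightarrow> (nat set \<Rightarrow> real) \<Rightarrow> real" where
  "schedule_length N T = (\<Sum>c\<in>groups N. T c)"

definition optimal_schedule ::
    "nat \<Rightarrow> (nat \<Rightarrow> real) \<Rightarrow> (nat \<Rightarrow> real) \<Rightarrow> (nat set \<Rightarrow> real) \<Rightarrow> bool" where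
  "optimal_schedule N d r T \<longleftrightarrow>
     is_schedule N d r T \<and>
     (\<forall>T'. is_schedule N d r T' \<longrightarrow> schedule_length N T \<le> schedule_length N T')"

definition backlogged :: "nat \<Rightarrow> (nat \<Rightarrow> real) \<Rightarrow> nat set" where
  "backlogged N q = {i \<in> links N. 0 < q i}"

text \<open>Time until the first queue of \<open>c\<close> empties when \<open>c\<close> is activated with queue contents \<open>q\<close>;
  the case \<open>c = {}\<close> (everything already served) is explicit because \<open>Min {}\<close> is unspecified.\<close>

definition emptying_time :: "(nat \<Rightarrow> real) \<Rightarrow> (nat \<Rightarrow> real) \<Rightarrow> nat set \<Rightarrow> real" where
  "emptying_time r q c = (if c = {} then 0 else Min ((\<lambda>i. q i / service_rate r c i) ` c))"

text \<open>\<open>all_queue N d r k\<close> is the vector of remaining demands after \<open>k\<close> phases of the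
  all-at-once strategy.\<close>

fun all_queue :: "nat \<Rightarrow> (nat \<Rightarrow> real) \<Rightarrow> (nat \<Rightarrow> real) \<Rightarrow> nat \<Rightarrow> nat \<Rightarrow> real" where
  "all_queue N d r 0 = d"
| "all_queue N d r (Suc k) =
     (let q = all_queue N d r k; c = backlogged N q
      in (\<lambda>i. q i - service_rate r c i * emptying_time r q c))"

definition all_group :: "nat \<Rightarrow> (nat \<Rightarrow> real) \<Rightarrow> (nat \<Rightarrow> real) \<Rightarrow> nat \<Rightarrow> nat set" where
  "all_group N d r k = backlogged N (all_queue N d r k)"

definition all_duration :: "nat \<Rightarrow> (nat \<Rightarrow> real) \<Rightarrow> (nat \<Rightarrow> real) \<Rightarrow> nat \<Rightarrow> real" where
  "all_duration N d r k = emptying_time r (all_queue N d r k) (all_group N d r k)"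

text \<open>Every phase with a nonempty group empties at least one queue, so \<open>N\<close> phases always suffice;
  phases after the last queue has emptied have group \<open>{}\<close> and duration \<open>0\<close>.\<close>

definition all_at_once :: "nat \<Rightarrow> (nat \<Rightarrow> real) \<Rightarrow> (nat \<Rightarrow> real) \<Rightarrow> nat set \<Rightarrow> real" where
  "all_at_once N d r c = (\<Sum>k\<in>{k. k < N \<and> all_group N d r k = c}. all_duration N d r k)"

definition all_nondegenerate :: "nat \<Rightarrow> (nat \<Rightarrow> real) \<Rightarrow> (nat \<Rightarrow> real) \<Rightarrow> bool" where
  "all_nondegenerate N d r \<longleftrightarrow>
     (\<forall>k<N. all_group N d r k \<in> groups N \<and> 0 < all_duration N d r k)"

end

theory Submission
  imports Defs
begin

text \<open>Non-degeneracy forces the groups of the all-at-once strategy to lose exactly one link per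
  phase, so it runs groups \<open>G\<close>, \<open>G - {a}\<close>, \<open>G - {a, b}\<close> of sizes \<open>m\<close>, \<open>m - 1\<close>, \<open>m - 2\<close> for positive
  times. As \<open>G\<close> and \<open>G - {a, b}\<close> together cover the same links, with multiplicity, as
  \<open>G - {a}\<close> and \<open>G - {b}\<close>, a small amount \<open>s\<close> of service can be moved from the first pair to the
  second. This changes the length by \<open>s (2 / r (m - 1) - 1 / r m - 1 / r (m - 2))\<close>, which
  is nonnegative if the strategy is optimal.\<close>

lemma finite_groups [simp]: "finite (groups N)"
  by (simp add: groups_def links_def)

lemma card_groups:
  assumes "c \<in> groups N"
  shows "1 \<le> card c" "card c \<le> N"
proof -
  have "c \<subseteq> {1..N}" "c \<noteq> {}"
    using assms by (auto simp: groups_def links_def)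
  then show "1 \<le> card c" "card c \<le> N"
    using card_mono[of "{1..N}" c] finite_subset[of c "{1..N}"]
    by (auto simp: Suc_le_eq card_gt_0_iff)
qed

lemma rate_pos:
  assumes "cardinality_instance N d r" "1 \<le> k" "k \<le> N"
  shows "0 < r k"
proof -
  have "r N \<le> r k"
    using assms monotone_onD[of "{1..N}" "(\<le>)" "(\<ge>)" r k N]
    by (auto simp: cardinality_instance_def)
  then show ?thesis
    using assms by (simp add: cardinality_instance_def)
qed

text \<open>\<open>T\<close> is compared with a single competitor. If \<open>card G = 2\<close>,
  then \<open>G - {a, b}\<close> is empty and hence no group; this is why its positivity is assumed
  conditionally and its term is replaced by 0.\<close>

lemma optimal_exchange:
  assumes opt: "optimal_schedule N d r T"
    and rpos: "\<And>k. 1 \<le> k \<Longrightarrow> k \<le> N \<Longrightarrow> 0 < r k"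
    and G: "G \<in> groups N" "a \<in> G" "b \<in> G" "a \<noteq> b"
    and TG: "0 < T G"
    and TH: "G - {a, b} \<noteq> {} \<Longrightarrow> 0 < T (G - {a, b})"
  shows "1 / r (card G) + (if card G = 2 then 0 else 1 / r (card G - 2)) \<le> 2 / r (card G - 1)"
proof -
  define m where "m = card G"
  define H where "H = G - {a, b}"
  have fin: "finite G"
    using G by (auto simp: groups_def links_def intro: finite_subset)
  have cH: "card H = m - 2"
    using fin G by (simp add: H_def m_def card_Diff_subset)
  have cA: "card (G - {a}) = m - 1" "card (G - {b}) = m - 1"
    using fin G by (simp_all add: m_def)
  have m2: "2 \<le> m"
    using card_mono[of G "{a, b}"] fin G by (simp add: m_def)
  have mN: "m \<le> N"
    using card_groups[OF G(1)] by (simp add: m_def)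
  have H_empty: "H = {} \<longleftrightarrow> m = 2"
    using cH m2 fin card_eq_0_iff[of H] by (simp add: H_def)
  have gA: "G - {a} \<in> groups N" "G - {b} \<in> groups N"
    using G by (auto simp: groups_def)
  have gH: "H \<in> groups N \<longleftrightarrow> m \<noteq> 2"
    using G H_empty by (auto simp: groups_def H_def)
  have pos: "0 < r m" "0 < r (m - 1)" "m \<noteq> 2 \<Longrightarrow> 0 < r (m - 2)"
    using m2 mN by (auto intro!: rpos)
  \<comment> \<open>The largest amount whose removal keeps the times of \<open>G\<close> and, when
    it is a group, \<open>H\<close> nonnegative.\<close>
  define s where "s = (if m = 2 then r m * T G else min (r m * T G) (r (m - 2) * T H))"
  have s: "0 < s" "s / r m \<le> T G" "m \<noteq> 2 \<Longrightarrow> s / r (m - 2) \<le> T H"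
    using pos TG TH H_empty by (auto simp: s_def H_def field_simps min_def)
  \<comment> \<open>Dividing \<open>s\<close> by the rate of each group makes every member gain or
    lose exactly \<open>s\<close>. For \<open>m = 2\<close> the last term only alters the value at
    \<open>{}\<close>, outside \<open>groups N\<close>, so the arbitrary \<open>r 0\<close> does no
    harm.\<close>
  define T' where "T' c = T c + (if c = G - {a} then s / r (m - 1) else 0)
      + (if c = G - {b} then s / r (m - 1) else 0)
      - (if c = G then s / r m else 0) - (if c = H then s / r (m - 2) else 0)" for c
  have distinct: "G - {a} \<noteq> G - {b}" "G - {a} \<noteq> G" "G - {b} \<noteq> G"
    "H \<noteq> G" "H \<noteq> G - {a}" "H \<noteq> G - {b}"
    using G by (auto simp: H_def)
  have sched: "is_schedule N d r T"
    and least: "\<And>S. is_schedule N d r S \<Longrightarrow> schedule_length N T \<le> schedule_length N S"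
    using opt by (auto simp: optimal_schedule_def)
  have if_mult: "x * (if P then y else 0) = (if P then x * y else (0::real))" for x y P
    by simp
  have "is_schedule N d r T'"
    unfolding is_schedule_def
  proof (intro conjI ballI)
    fix c assume c: "c \<in> groups N"
    then have "0 \<le> T c"
      using sched by (simp add: is_schedule_def)
    then show "0 \<le> T' c"
      using c s pos gH distinct by (auto simp: T'_def)
  next
    fix i assume i: "i \<in> links N"
    let ?I = "{c \<in> groups N. i \<in> c}"
    have [simp]: "finite ?I" by simp
    have "(\<Sum>c\<in>?I. r (card c) * T' c) = (\<Sum>c\<in>?I. r (card c) * T c
        + (if c = G - {a} then r (card c) * (s / r (m - 1)) else 0)
        + (if c = G - {b} then r (card c) * (s / r (m - 1)) else 0)
        - (if c = G then r (card c) * (s / r m) else 0)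
        - (if c = H then r (card c) * (s / r (m - 2)) else 0))"
      unfolding T'_def ring_distribs if_mult ..
    also have "\<dots> = (\<Sum>c\<in>?I. r (card c) * T c)
        + (if i \<in> G - {a} then s else 0) + (if i \<in> G - {b} then s else 0)
        - (if i \<in> G then s else 0) - (if i \<in> H then s else 0)"
      unfolding sum.distrib sum_subtractf
      using pos gA gH G H_empty cA cH by (auto simp: sum.delta m_def[symmetric])
    \<comment> \<open>The links \<open>a\<close> and \<open>b\<close> each lie in \<open>G\<close>
      and in one of the two enlarged groups; any other link of \<open>G\<close> lies in all four, so
      the contributions cancel.\<close>
    also have "\<dots> = (\<Sum>c\<in>?I. r (card c) * T c)"
      using G by (auto simp: H_def)
    also have "\<dots> = d i"
      using sched i by (simp add: is_schedule_def)
    finally show "(\<Sum>c\<in>?I. r (card c) * T' c) = d i" .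
  qed
  then have "schedule_length N T \<le> schedule_length N T'"
    by (rule least)
  also have "\<dots> = schedule_length N T + 2 * (s / r (m - 1)) - s / r m
      - (if m = 2 then 0 else s / r (m - 2))"
    unfolding schedule_length_def T'_def sum.distrib sum_subtractf
    using gA gH G by (auto simp: sum.delta)
  finally have "s * (1 / r m + (if m = 2 then 0 else 1 / r (m - 2))) \<le> s * (2 / r (m - 1))"
    by (auto simp: algebra_simps)
  then show ?thesis
    using s(1) unfolding m_def[symmetric] by (simp only: mult_le_cancel_left_pos)
qed

text \<open>A link attaining the minimum in \<open>emptying_time\<close> ends with queue exactly 0
  and drops out. A link outside the group is not served and had no positive queue, so it cannot
  enter.\<close>

lemma all_group_Suc_psubset:
  assumes inst: "cardinality_instance N d r"
    and grp: "all_group N d r k \<in> groups N"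
  shows "all_group N d r (Suc k) \<subset> all_group N d r k"
proof -
  define q where "q = all_queue N d r k"
  define c where "c = backlogged N q"
  have c: "c = all_group N d r k"
    by (simp add: c_def q_def all_group_def)
  have ne: "c \<noteq> {}" and fin: "finite c"
    using grp by (auto simp: c groups_def links_def intro: finite_subset)
  have rc: "0 < r (card c)"
    using rate_pos[OF inst] card_groups grp c by simp
  define t where "t = emptying_time r q c"
  have Suc: "all_queue N d r (Suc k) i = q i - service_rate r c i * t" for i
    by (simp add: q_def c_def t_def Let_def)
  have "t = Min ((\<lambda>i. q i / service_rate r c i) ` c)"
    using ne by (simp add: t_def emptying_time_def)
  then obtain j where j: "j \<in> c" "t = q j / service_rate r c j"
    using Min_in[of "(\<lambda>i. q i / service_rate r c i) ` c"] fin ne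
    by (metis (no_types, lifting) finite_imageI image_iff image_is_empty)
  have "all_queue N d r (Suc k) j = 0"
    unfolding Suc using j rc by (simp add: service_rate_def)
  then have "j \<notin> all_group N d r (Suc k)"
    by (simp add: all_group_def backlogged_def del: all_queue.simps)
  moreover have "all_group N d r (Suc k) \<subseteq> c"
  proof
    fix i assume "i \<in> all_group N d r (Suc k)"
    then have i: "i \<in> links N" "0 < q i - service_rate r c i * t"
      unfolding all_group_def backlogged_def Suc by auto
    show "i \<in> c"
    proof (rule ccontr)
      assume "i \<notin> c"
      with i show False
        by (simp add: service_rate_def c_def backlogged_def)
    qed
  qed
  ultimately show ?thesis
    using j c by blast
qed

text \<open>The \<open>N\<close> groups are nonempty, have at most \<open>N\<close> links and shrink
  strictly, which leaves only one possible size for each.\<close>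

lemma card_all_group:
  assumes inst: "cardinality_instance N d r"
    and nondeg: "all_nondegenerate N d r"
    and "k < N"
  shows "card (all_group N d r k) = N - k"
proof -
  let ?G = "all_group N d r"
  have grp: "?G k \<in> groups N" if "k < N" for k
    using nondeg that by (simp add: all_nondegenerate_def)
  have less: "card (?G (Suc k)) < card (?G k)" if "k < N" for k
    using all_group_Suc_psubset[OF inst grp[OF that]] grp[OF that]
    by (auto simp: groups_def links_def intro!: psubset_card_mono intro: finite_subset)
  have upper: "k < N \<Longrightarrow> card (?G k) + k \<le> N" for k
  proof (induction k)
    case 0
    then show ?case using card_groups[OF grp] by simp
  next
    case (Suc k)
    then show ?case using less[of k] by simp
  qed
  \<comment> \<open>Induction backwards from the last phase \<open>N - 1\<close>, whose group is
    nonempty.\<close>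
  have lower: "j < N \<Longrightarrow> j + 1 \<le> card (?G (N - Suc j))" for j
  proof (induction j)
    case 0
    then show ?case using card_groups[OF grp[of "N - 1"]] by simp
  next
    case (Suc j)
    then have "Suc (N - Suc (Suc j)) = N - Suc j" by simp
    then show ?case using Suc less[of "N - Suc (Suc j)"] by simp
  qed
  show ?thesis
    using upper[of k] lower[of "N - Suc k"] \<open>k < N\<close> by simp
qed

text \<open>Phase \<open>k\<close> contributes a positive duration, and any other phase with the
  same group would only add to it.\<close>

lemma all_at_once_pos:
  assumes "all_nondegenerate N d r" "k < N"
  shows "0 < all_at_once N d r (all_group N d r k)"
  unfolding all_at_once_def
  using assms by (intro sum_pos) (auto simp: all_nondegenerate_def)

theorem theorem12:
  fixes N :: nat and d r :: "nat \<Rightarrow> real"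
  assumes "cardinality_instance N d r"
    and "all_nondegenerate N d r"
    and "optimal_schedule N d r (all_at_once N d r)"
  shows "\<forall>m\<in>{2..N}. 1 / r m + (if m = 2 then 0 else 1 / r (m - 2)) \<le> 2 / r (m - 1)"
proof
  fix m assume m: "m \<in> {2..N}"
  \<comment> \<open>The phase in which exactly \<open>m\<close> links are still backlogged.\<close>
  define k where "k = N - m"
  let ?G = "all_group N d r"
  have k: "k < N" "Suc k < N" and Nk: "N - k = m" "N - Suc k = m - 1"
    using m by (auto simp: k_def)
  have grp: "?G i \<in> groups N" if "i < N" for i
    using assms(2) that by (simp add: all_nondegenerate_def)
  have card: "card (?G i) = N - i" if "i < N" for i
    using card_all_group[OF assms(1,2) that] .
  have fin: "finite (?G i)" for i
    by (simp add: all_group_def backlogged_def links_def)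
  have sub: "?G (Suc i) \<subset> ?G i" if "i < N" for i
    using all_group_Suc_psubset[OF assms(1) grp[OF that]] .
  have remove_one: "\<exists>x\<in>?G i. ?G (Suc i) = ?G i - {x}" if "Suc i < N" for i
  proof -
    have "card (?G i - ?G (Suc i)) = 1"
      using that sub[of i] card[of i] card[of "Suc i"] fin
      by (subst card_Diff_subset) auto
    then obtain x where "?G i - ?G (Suc i) = {x}"
      by (auto simp: card_1_singleton_iff)
    then show ?thesis
      using sub[of i] that by (intro bexI[of _ x]) auto
  qed
  obtain a where a: "a \<in> ?G k" "?G (Suc k) = ?G k - {a}"
    using remove_one k by blast
  \<comment> \<open>If phase \<open>Suc k\<close> is the last one (\<open>m = 2\<close>),
    \<open>b\<close> is any link of its group; otherwise it is the link that this phase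
    empties.\<close>
  obtain b where b: "b \<in> ?G (Suc k)"
    and b': "Suc (Suc k) < N \<Longrightarrow> ?G (Suc (Suc k)) = ?G (Suc k) - {b}"
    using remove_one[of "Suc k"] grp[OF k(2)] by (auto simp: groups_def)
  have diff: "?G k - {a, b} = ?G (Suc k) - {b}"
    using a by auto
  \<comment> \<open>Nonemptiness means \<open>m > 2\<close>, so phase \<open>k + 2\<close> exists
    and runs exactly this group.\<close>
  have "0 < all_at_once N d r (?G k - {a, b})" if ne: "?G k - {a, b} \<noteq> {}"
  proof -
    have "card (?G (Suc k) - {b}) = m - 2"
      using b fin card[OF k(2)] Nk by simp
    moreover have "card (?G (Suc k) - {b}) \<noteq> 0"
      using ne diff fin by simp
    ultimately have "Suc (Suc k) < N"
      using Nk by simp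
    then show ?thesis
      using all_at_once_pos[OF assms(2)] b' diff by metis
  qed
  then show "1 / r m + (if m = 2 then 0 else 1 / r (m - 2)) \<le> 2 / r (m - 1)"
    using optimal_exchange[OF assms(3) rate_pos[OF assms(1)] grp[OF k(1)], of a b]
      all_at_once_pos[OF assms(2) k(1)] a b card[OF k(1)] Nk
    by auto
qed

end
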